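(* Let $k_1,k_2,k_3,\dots$ be positive integers with $2\leq k_1\leq k_2\leq k_3\leq\cdots$. Then for any coloring of $\mathbb{N}$ with finitely many colors, there exist positive integers $d_1,d_2,d_3,\dots$ and a color $\gamma$ such that for every $n\in\mathbb{N}$ there exists a positive integer $a_n$ such that the set \[ \{a_n+j_1d_1+\cdots+j_nd_n \mid 0\leq j_1\leq k_1-1,\dots,0\leq j_n\leq k_n-1\} \] is monochromatic with color $\gamma$, and moreover the set $\{d_1,d_2,d_3,\dots\}$ is monochromatic with color $\gamma$.
   Context: $\mathbb{N}$ denotes the set of positive integers. *)

theory Defs
  imports Main
begin

end

theory Submission imports Defs begin

text \<open>
  Two partition regular notions are played off against each other. A set is piecewise syndetic
  if it has gaps bounded by a fixed constant on arbitrarily long intervals; a set \<open>E\<close> is large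
  if every finite coloring has long monochromatic progressions with difference in \<open>E\<close>.
  The union of the color classes that are not piecewise syndetic is not piecewise syndetic, so
  its complement contains arbitrarily long intervals and, by color focusing, is large. Hence one
  color class \<open>A\<close> is at the same time piecewise syndetic and large. If \<open>B\<close> is piecewise syndetic,
  then for some \<open>d\<close> in the large set \<open>A\<close> so is the set of \<open>x\<close> with \<open>x, x + d, \<dots>, x + k d \<in> B\<close>;
  iterating this from \<open>B = A\<close> yields the differences one after another.
\<close>

section \<open>Thick, piecewise syndetic and large sets\<close>

definition thick :: "nat set \<Rightarrow> bool" where
  "thick T \<longleftrightarrow> (\<forall>M. \<exists>x. \<forall>e\<le>M. x + e \<in> T)"

definition piecewise_syndetic :: "nat set \<Rightarrow> bool" where
  "piecewise_syndetic A \<longleftrightarrow> (\<exists>m. \<forall>N. \<exists>x. \<forall>y\<le>N. \<exists>f\<le>m. x + y + f \<in> A)"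

text \<open>The bound \<open>d \<le> N\<close> leaves only finitely many differences, also for
  \<open>k = 0\<close>, where \<open>a + k * d \<le> N\<close> does not restrict
  \<open>d\<close>.\<close>

definition has_mono_ap :: "(nat \<Rightarrow> 'a) \<Rightarrow> nat \<Rightarrow> nat set \<Rightarrow> nat \<Rightarrow> bool" where
  "has_mono_ap c k T N \<longleftrightarrow>
    (\<exists>a d. d \<in> T \<and> d \<le> N \<and> a + k * d \<le> N \<and> (\<forall>j\<le>k. c (a + j * d) = c a))"

text \<open>\<open>N\<close> is uniform over the colorings, so the condition applies inside windows
  of fixed length. Difference 0 is excluded later, by taking \<open>T\<close> among the positive
  integers.\<close>

definition ap_large :: "nat \<Rightarrow> nat set \<Rightarrow> bool" where
  "ap_large k T \<longleftrightarrow>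
    (\<forall>r. \<exists>N. \<forall>c :: nat \<Rightarrow> nat. (\<forall>x. c x < r) \<longrightarrow> has_mono_ap c k T N)"

section \<open>Partition regularity of largeness\<close>

lemma has_mono_ap_mono:
  assumes "has_mono_ap c k T N" "T \<subseteq> T'" "N \<le> N'"
  shows "has_mono_ap c k T' N'"
  using assms unfolding has_mono_ap_def by (meson order_trans subsetD)

lemma has_mono_ap_antimono_length:
  assumes "has_mono_ap c k T N" "l \<le> k"
  shows "has_mono_ap c l T N"
proof -
  obtain a d where ad: "d \<in> T" "d \<le> N" "a + k * d \<le> N" "\<forall>j\<le>k. c (a + j * d) = c a"
    using assms unfolding has_mono_ap_def by blast
  have "a + l * d \<le> N"
    using ad(3) mult_le_mono1[OF assms(2), of d] by linarith
  then show ?thesis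
    using ad assms(2) unfolding has_mono_ap_def by (meson order_trans)
qed

lemma has_mono_ap_shift:
  assumes "has_mono_ap (\<lambda>u. c (x + u)) k T N"
  shows "has_mono_ap c k T (x + N)"
proof -
  obtain a d where "d \<in> T" "d \<le> N" "a + k * d \<le> N"
      "\<forall>j\<le>k. c (x + (a + j * d)) = c (x + a)"
    using assms unfolding has_mono_ap_def by blast
  then show ?thesis
    unfolding has_mono_ap_def by (intro exI[of _ "x + a"] exI[of _ d]) (auto simp: add.assoc)
qed

lemma ap_large_antimono:
  assumes "ap_large k T" "l \<le> k"
  shows "ap_large l T"
  using assms unfolding ap_large_def by (meson has_mono_ap_antimono_length)

lemma ap_large_finite_colors:
  assumes "ap_large k T" "finite C"
  obtains N where "\<And>c :: nat \<Rightarrow> 'a. range c \<subseteq> C \<Longrightarrow> has_mono_ap c k T N"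
proof -
  obtain g :: "'a \<Rightarrow> nat" where g: "bij_betw g C {0..<card C}"
    using ex_bij_betw_finite_nat[OF assms(2)] by blast
  obtain N where N: "\<And>c :: nat \<Rightarrow> nat. (\<forall>x. c x < card C) \<Longrightarrow> has_mono_ap c k T N"
    using assms(1) unfolding ap_large_def by blast
  have "has_mono_ap c k T N" if c: "range c \<subseteq> C" for c :: "nat \<Rightarrow> 'a"
  proof -
    have "has_mono_ap (g \<circ> c) k T N"
      using c bij_betwE[OF g] by (intro N) (auto simp: image_subset_iff)
    moreover have "g (c x) = g (c y) \<longleftrightarrow> c x = c y" for x y
      using c bij_betw_imp_inj_on[OF g] by (auto simp: inj_on_def image_subset_iff)
    ultimately show ?thesis
      unfolding has_mono_ap_def by simp
  qed
  then show ?thesis using that by blast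
qed

text \<open>A progression that is monochromatic for the pairing of a bad coloring for
  \<open>S\<close> with one for \<open>T\<close> is so for both, hence its difference can lie in
  neither set.\<close>

lemma ap_large_Un:
  assumes "ap_large k (S \<union> T)"
  shows "ap_large k S \<or> ap_large k T"
proof (rule ccontr)
  assume "\<not> ?thesis"
  then have "\<not> ap_large k S" "\<not> ap_large k T" by auto
  then obtain r s where
    r: "\<nexists>N. \<forall>c :: nat \<Rightarrow> nat. (\<forall>x. c x < r) \<longrightarrow> has_mono_ap c k S N" and
    s: "\<nexists>N. \<forall>c :: nat \<Rightarrow> nat. (\<forall>x. c x < s) \<longrightarrow> has_mono_ap c k T N"
    unfolding ap_large_def not_all by (elim exE)
  obtain N where N: "\<And>c :: nat \<Rightarrow> nat \<times> nat.
      range c \<subseteq> {..<r} \<times> {..<s} \<Longrightarrow> has_mono_ap c k (S \<union> T) N"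
    by (rule ap_large_finite_colors[OF assms, of "{..<r} \<times> {..<s}"]) auto
  obtain c1 where c1: "\<forall>x. c1 x < r" "\<not> has_mono_ap c1 k S N" using r by blast
  obtain c2 where c2: "\<forall>x. c2 x < s" "\<not> has_mono_ap c2 k T N" using s by blast
  have "has_mono_ap (\<lambda>x. (c1 x, c2 x)) k (S \<union> T) N"
    using c1(1) c2(1) by (intro N) auto
  then show False
    using c1(2) c2(2) unfolding has_mono_ap_def prod.inject by blast
qed

lemma not_ap_large_empty: "\<not> ap_large k {}"
  unfolding ap_large_def has_mono_ap_def by (auto intro!: exI[of _ 1])

lemma ap_large_UN:
  assumes "finite I" "ap_large k (\<Union>i\<in>I. E i)"
  shows "\<exists>i\<in>I. ap_large k (E i)"
  using assms
proof (induction I rule: finite_induct)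
  case empty
  then show ?case by (simp add: not_ap_large_empty)
next
  case (insert i I)
  then show ?case using ap_large_Un[of k "E i" "\<Union>i\<in>I. E i"] by auto
qed

section \<open>Color focusing: thick sets are large\<close>

text \<open>Provides differences \<open>d\<close> that stay in \<open>T\<close> under every
  correction \<open>d + e\<close> with \<open>e \<le> N\<close>.\<close>

lemma thick_shift:
  assumes "thick T"
  shows "thick {d. \<forall>e\<le>N. d + e \<in> T}"
  unfolding thick_def
proof
  fix M
  obtain x where "\<forall>e\<le>M + N. x + e \<in> T" using assms unfolding thick_def by blast
  then show "\<exists>x. \<forall>e\<le>M. x + e \<in> {d. \<forall>e\<le>N. d + e \<in> T}"
    by (intro exI[of _ x]) (auto simp: add.assoc)
qed

text \<open>
  A focus \<open>y\<close> of the color set \<open>G\<close>: the one-sided progressions \<open>y + j d\<close>, \<open>j = 1, \<dots>, k\<close>, realize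
  all colors of \<open>G\<close>. If \<open>y\<close> itself has one of these colors, a progression is extended to \<open>j = 0\<close>.
\<close>
definition focus :: "(nat \<Rightarrow> 'a) \<Rightarrow> nat \<Rightarrow> nat set \<Rightarrow> nat \<Rightarrow> 'a set \<Rightarrow> nat \<Rightarrow> bool" where
  "focus c k T N G y \<longleftrightarrow> y \<le> N \<and>
    (\<forall>\<gamma>\<in>G. \<exists>d\<in>T. d \<le> N \<and> y + k * d \<le> N \<and> (\<forall>j\<in>{1..k}. c (y + j * d) = \<gamma>))"

lemma focus_imp_has_mono_ap:
  assumes "focus c k T N G y" "c y \<in> G"
  shows "has_mono_ap c k T N"
proof -
  obtain d where d: "d \<in> T" "d \<le> N" "y + k * d \<le> N" "\<forall>j\<in>{1..k}. c (y + j * d) = c y"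
    using assms unfolding focus_def by blast
  have "c (y + j * d) = c y" if "j \<le> k" for j
    using d(4) that by (cases "j = 0") auto
  then show ?thesis using d unfolding has_mono_ap_def by blast
qed

text \<open>Induction on \<open>s\<close>: largeness for length \<open>k\<close> finds equally
  spaced windows with the same color pattern; a focus of \<open>s\<close> colors in the first window
  then yields a focus of one more color.\<close>

lemma focusing:
  fixes C :: "nat set"
  assumes IH: "\<And>T. thick T \<Longrightarrow> ap_large k T" and T: "thick T" and C: "finite C"
  shows "\<exists>N. \<forall>c. range c \<subseteq> C \<longrightarrow> has_mono_ap c (Suc k) T N \<or>
           (\<exists>G y. G \<subseteq> C \<and> card G = s \<and> focus c (Suc k) T N G y)"
proof (induction s)
  case 0
  show ?case
    by (rule exI[of _ 0]) (auto simp: focus_def intro!: exI[of _ "{}"])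
next
  case (Suc s)
  then obtain N where N: "\<And>c. range c \<subseteq> C \<Longrightarrow> has_mono_ap c (Suc k) T N \<or>
           (\<exists>G y. G \<subseteq> C \<and> card G = s \<and> focus c (Suc k) T N G y)"
    by blast
  define T' where "T' = {d. \<forall>e\<le>N. d + e \<in> T}"
  \<comment> \<open>The possible color patterns of a window of length \<open>N + 1\<close>; they
    serve as colors.\<close>
  define B where "B = {xs. set xs \<subseteq> C \<and> length xs = Suc N}"
  have "finite B" unfolding B_def by (rule finite_lists_length_eq[OF C])
  moreover have "ap_large k T'" unfolding T'_def by (intro IH thick_shift T)
  ultimately obtain M where M: "\<And>c :: nat \<Rightarrow> nat list. range c \<subseteq> B \<Longrightarrow> has_mono_ap c k T' M"
    using ap_large_finite_colors by blast
  define L where "L = 2 * M + N + N * Suc k + Suc k * M"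
  have "has_mono_ap c (Suc k) T L \<or>
       (\<exists>G y. G \<subseteq> C \<and> card G = Suc s \<and> focus c (Suc k) T L G y)" if c: "range c \<subseteq> C" for c
  proof (unfold disj_imp, rule impI)
    assume no_ap: "\<not> has_mono_ap c (Suc k) T L"
    \<comment> \<open>The offset \<open>M\<close> leaves room to step back by
      \<open>d \<le> M\<close> to the new focus.\<close>
    define b where "b x = map (\<lambda>u. c (M + x + u)) [0..<Suc N]" for x
    have "range b \<subseteq> B" using c by (auto simp: b_def B_def image_subset_iff)
    then obtain a d where ad: "d \<in> T'" "d \<le> M" "a + k * d \<le> M" "\<forall>j\<le>k. b (a + j * d) = b a"
      using M unfolding has_mono_ap_def by blast
    have periodic: "c (M + (a + j * d) + u) = c (M + a + u)" if "j \<le> k" "u \<le> N" for j u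
    proof -
      have "b (a + j * d) ! u = b a ! u" using ad(4) that(1) by simp
      then show ?thesis using that(2) by (simp add: b_def del: upt_Suc)
    qed
    have T'T: "d + e \<in> T" if "e \<le> N" for e using ad(1) that by (simp add: T'_def)
    have "range (\<lambda>u. c (M + a + u)) \<subseteq> C" using c by auto
    then have "has_mono_ap (\<lambda>u. c (M + a + u)) (Suc k) T N \<or>
        (\<exists>G y. G \<subseteq> C \<and> card G = s \<and> focus (\<lambda>u. c (M + a + u)) (Suc k) T N G y)"
      by (rule N)
    moreover have no_ap_block: "\<not> has_mono_ap (\<lambda>u. c (M + a + u)) (Suc k) T N"
    proof
      assume "has_mono_ap (\<lambda>u. c (M + a + u)) (Suc k) T N"
      from has_mono_ap_shift[OF this] have "has_mono_ap c (Suc k) T L"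
        by (rule has_mono_ap_mono) (use ad(3) in \<open>auto simp: L_def\<close>)
      then show False using no_ap by simp
    qed
    ultimately obtain G y where G: "G \<subseteq> C" "card G = s"
      and y: "focus (\<lambda>u. c (M + a + u)) (Suc k) T N G y" by blast
    define \<gamma>0 where "\<gamma>0 = c (M + a + y)"
    have new: "\<gamma>0 \<notin> G"
      using focus_imp_has_mono_ap[OF y] no_ap_block by (auto simp: \<gamma>0_def)
    have yN: "y \<le> N" using y by (simp add: focus_def)
    \<comment> \<open>One step \<open>d\<close> before the position of \<open>y\<close> in the first
      window, so that the windows hold the terms \<open>j = 1, ..., Suc k\<close>.\<close>
    define z where "z = M + a + y - d"
    have z: "z + d = M + a + y" using ad(2) by (simp add: z_def)
    have zL: "z + Suc k * (d + e) \<le> L" if "e \<le> N" for e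
    proof -
      have "Suc k * e \<le> Suc k * N" "Suc k * d \<le> Suc k * M" using that ad(2) mult_le_mono2 by blast+
      moreover have "z \<le> 2 * M + N" using z ad(3) yN by linarith
      ultimately show ?thesis unfolding L_def add_mult_distrib2 by (simp add: mult.commute)
    qed
    \<comment> \<open>Term \<open>j\<close> lies in window \<open>j - 1\<close> at position
      \<open>y + j * e\<close>; by periodicity it has the color of that position in the first
      window.\<close>
    have reach: "c (z + j * (d + e)) = c (M + a + (y + j * e))"
      if j: "j \<in> {1..Suc k}" and le: "y + j * e \<le> N" for j e
    proof -
      obtain i where i: "j = Suc i" "i \<le> k" using j by (cases j) auto
      have "z + j * (d + e) = M + (a + i * d) + (y + j * e)"
        using z by (simp add: i(1) algebra_simps)
      then show ?thesis using periodic[OF i(2) le] by simp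
    qed
    have "focus c (Suc k) T L (insert \<gamma>0 G) z"
      unfolding focus_def
    proof (intro conjI ballI)
      show "z \<le> L" using zL[of 0] by simp
    next
      fix \<gamma> assume "\<gamma> \<in> insert \<gamma>0 G"
      then consider "\<gamma> = \<gamma>0" | "\<gamma> \<in> G" by blast
      \<comment> \<open>The new color takes \<open>e = 0\<close>, the same position in all windows;
        an old color takes the difference of its own progression.\<close>
      then obtain e where e: "e \<le> N" "\<forall>j\<in>{1..Suc k}. y + j * e \<le> N \<and> c (M + a + (y + j * e)) = \<gamma>"
      proof cases
        case 1
        then show ?thesis using that[of 0] yN by (simp add: \<gamma>0_def)
      next
        case 2
        then obtain e where e: "e \<le> N" "y + Suc k * e \<le> N"
            "\<forall>j\<in>{1..Suc k}. c (M + a + (y + j * e)) = \<gamma>"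
          using y unfolding focus_def by blast
        have "y + j * e \<le> N" if "j \<in> {1..Suc k}" for j
          using e(2) mult_le_mono1[of j "Suc k" e] that by simp
        then show ?thesis using that e by blast
      qed
      have "d + e \<le> L" using zL[OF e(1)] by simp
      then show "\<exists>d\<in>T. d \<le> L \<and> z + Suc k * d \<le> L \<and> (\<forall>j\<in>{1..Suc k}. c (z + j * d) = \<gamma>)"
        using T'T[OF e(1)] zL[OF e(1)] reach e(2) by (intro bexI[of _ "d + e"]) auto
    qed
    moreover have "insert \<gamma>0 G \<subseteq> C" using c G(1) by (auto simp: \<gamma>0_def)
    moreover have "card (insert \<gamma>0 G) = Suc s"
      using new G finite_subset[OF G(1) C] by simp
    ultimately show "\<exists>G y. G \<subseteq> C \<and> card G = Suc s \<and> focus c (Suc k) T L G y" by blast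
  qed
  then show ?case by blast
qed

text \<open>Van der Waerden's theorem with differences from a thick set. \<open>T\<close> varies in
  the induction because focusing applies the hypothesis to a thick subset of
  \<open>T\<close>.\<close>

theorem thick_imp_ap_large:
  assumes "thick T"
  shows "ap_large k T"
  using assms
proof (induction k arbitrary: T)
  case 0
  then obtain d where "d \<in> T" unfolding thick_def by blast
  then have "has_mono_ap c 0 T d" for c :: "nat \<Rightarrow> nat"
    by (auto simp: has_mono_ap_def)
  then show ?case unfolding ap_large_def by blast
next
  case (Suc k)
  show ?case
    unfolding ap_large_def
  proof
    fix r
    \<comment> \<open>A focus of \<open>Suc r\<close> colors cannot exist with \<open>r\<close>
      colors, so the progression remains.\<close>
    obtain N where N: "\<And>c. range c \<subseteq> {..<r} \<Longrightarrow> has_mono_ap c (Suc k) T N \<or>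
           (\<exists>G y. G \<subseteq> {..<r} \<and> card G = Suc r \<and> focus c (Suc k) T N G y)"
      using focusing[OF Suc.IH Suc.prems finite_lessThan] by metis
    have "\<not> (G \<subseteq> {..<r} \<and> card G = Suc r)" for G
      using card_mono[of "{..<r}" G] by auto
    then have "has_mono_ap c (Suc k) T N" if "\<forall>x. c x < r" for c
      using N[of c] that by blast
    then show "\<exists>N. \<forall>c. (\<forall>x. c x < r) \<longrightarrow> has_mono_ap c (Suc k) T N" by blast
  qed
qed

section \<open>Piecewise syndetic sets\<close>

lemma not_piecewise_syndetic_empty: "\<not> piecewise_syndetic {}"
  unfolding piecewise_syndetic_def by auto

text \<open>If \<open>A\<close> fails, every stretch of length \<open>L\<close> contains the start
  of a gap of \<open>A\<close> of length \<open>m\<close>; the element of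
  \<open>A \<union> B\<close> found there lies in \<open>B\<close>, so \<open>B\<close> has gaps
  bounded by \<open>L + m\<close>.\<close>

lemma piecewise_syndetic_Un:
  assumes "piecewise_syndetic (A \<union> B)"
  shows "piecewise_syndetic A \<or> piecewise_syndetic B"
proof (unfold disj_imp, rule impI)
  assume "\<not> piecewise_syndetic A"
  obtain m where m: "\<And>N. \<exists>x. \<forall>y\<le>N. \<exists>f\<le>m. x + y + f \<in> A \<union> B"
    using assms unfolding piecewise_syndetic_def by blast
  obtain L where L: "\<And>x. \<exists>y\<le>L. \<forall>f\<le>m. x + y + f \<notin> A"
    using \<open>\<not> piecewise_syndetic A\<close> unfolding piecewise_syndetic_def by metis
  have "\<exists>x. \<forall>y\<le>N. \<exists>f\<le>L + m. x + y + f \<in> B" for N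
  proof -
    obtain x where x: "\<And>y. y \<le> N + L \<Longrightarrow> \<exists>f\<le>m. x + y + f \<in> A \<union> B" using m by blast
    have "\<exists>f\<le>L + m. x + y + f \<in> B" if "y \<le> N" for y
    proof -
      obtain z where z: "z \<le> L" "\<forall>f\<le>m. x + y + z + f \<notin> A" using L by blast
      obtain f where "f \<le> m" "x + (y + z) + f \<in> A \<union> B"
        using x[of "y + z"] \<open>y \<le> N\<close> z(1) by auto
      then show ?thesis
        using z by (intro exI[of _ "z + f"]) (auto simp: add.assoc)
    qed
    then show ?thesis by blast
  qed
  then show "piecewise_syndetic B" unfolding piecewise_syndetic_def by blast
qed

lemma piecewise_syndetic_UN:
  assumes "finite I" "piecewise_syndetic (\<Union>i\<in>I. A i)"
  shows "\<exists>i\<in>I. piecewise_syndetic (A i)"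
  using assms
proof (induction I rule: finite_induct)
  case empty
  then show ?case by (simp add: not_piecewise_syndetic_empty)
next
  case (insert i I)
  then show ?case using piecewise_syndetic_Un[of "A i" "\<Union>i\<in>I. A i"] by auto
qed

lemma thick_if_not_piecewise_syndetic:
  assumes "\<not> piecewise_syndetic Q" "{1..} \<subseteq> P \<union> Q"
  shows "thick P"
  unfolding thick_def
proof
  fix M
  obtain N where "\<forall>x. \<exists>y\<le>N. \<forall>f\<le>M. x + y + f \<notin> Q"
    using assms(1) unfolding piecewise_syndetic_def by metis
  \<comment> \<open>Starting from 1 keeps the gap of \<open>Q\<close> among the positive integers,
    which \<open>P \<union> Q\<close> covers.\<close>
  then obtain y where "\<forall>f\<le>M. 1 + y + f \<notin> Q" by blast
  then show "\<exists>x. \<forall>e\<le>M. x + e \<in> P"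
    using assms(2) by (intro exI[of _ "1 + y"]) auto
qed

text \<open>Color each position by a distance of at most \<open>m\<close> to a later or equal
  element of \<open>A\<close>: a monochromatic progression, shifted by its common distance, lies in
  \<open>A\<close>. Only finitely many \<open>d \<le> N\<close> occur, so one of them works by
  partition regularity.\<close>

lemma piecewise_syndetic_ap_starts:
  assumes "piecewise_syndetic A" "ap_large k E"
  shows "\<exists>d\<in>E. piecewise_syndetic {x. \<forall>j\<le>k. x + j * d \<in> A}"
proof -
  obtain m where m: "\<And>N. \<exists>x. \<forall>y\<le>N. \<exists>f\<le>m. x + y + f \<in> A"
    using assms(1) unfolding piecewise_syndetic_def by blast
  obtain N where N: "\<And>c :: nat \<Rightarrow> nat. (\<forall>x. c x < Suc m) \<Longrightarrow> has_mono_ap c k E N"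
    using assms(2) unfolding ap_large_def by blast
  define U where "U = (\<Union>d\<in>E \<inter> {..N}. {x. \<forall>j\<le>k. x + j * d \<in> A})"
  have "\<exists>x. \<forall>y\<le>M. \<exists>f\<le>N + m. x + y + f \<in> U" for M
  proof -
    obtain x where x: "\<And>y. y \<le> M + N \<Longrightarrow> \<exists>f\<le>m. x + y + f \<in> A" using m by blast
    have "\<exists>f\<le>N + m. x + y + f \<in> U" if "y \<le> M" for y
    proof -
      \<comment> \<open>Beyond \<open>N\<close> the color is arbitrary, but still at most
        \<open>m\<close>.\<close>
      have "\<exists>f. f \<le> m \<and> (u \<le> N \<longrightarrow> x + (y + u) + f \<in> A)" for u
        using x[of "y + u"] \<open>y \<le> M\<close> by (cases "u \<le> N") auto
      then obtain c where c: "\<And>u. c u \<le> m" "\<And>u. u \<le> N \<Longrightarrow> x + (y + u) + c u \<in> A"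
        by metis
      obtain a d where ad: "d \<in> E" "d \<le> N" "a + k * d \<le> N" "\<forall>j\<le>k. c (a + j * d) = c a"
        using N[of c] c(1) unfolding has_mono_ap_def by (auto simp: less_Suc_eq_le)
      have "x + y + (a + c a) + j * d \<in> A" if "j \<le> k" for j
      proof -
        have "a + j * d \<le> N" using ad(3) mult_le_mono1[OF that, of d] by linarith
        from c(2)[OF this] have "x + (y + (a + j * d)) + c a \<in> A" using ad(4) that by simp
        then show ?thesis by (simp add: ac_simps)
      qed
      then have "x + y + (a + c a) \<in> U" using ad(1,2) by (auto simp: U_def)
      moreover have "a + c a \<le> N + m" using ad(3) c(1)[of a] by linarith
      ultimately show ?thesis by blast
    qed
    then show ?thesis by blast
  qed
  then have "piecewise_syndetic U" unfolding piecewise_syndetic_def by blast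
  then show ?thesis
    unfolding U_def using piecewise_syndetic_UN[of "E \<inter> {..N}"] by blast
qed

section \<open>A color class that is both piecewise syndetic and large\<close>

lemma piecewise_syndetic_large_color:
  fixes c :: "nat \<Rightarrow> 'color"
  assumes fin: "finite (c ` {1..})"
  obtains \<gamma> where "piecewise_syndetic {x. x \<ge> 1 \<and> c x = \<gamma>}"
    and "\<And>k. ap_large k {x. x \<ge> 1 \<and> c x = \<gamma>}"
proof -
  define K where "K \<gamma> = {x. x \<ge> 1 \<and> c x = \<gamma>}" for \<gamma>
  define I where "I = {\<gamma> \<in> c ` {1..}. piecewise_syndetic (K \<gamma>)}"
  define J where "J = c ` {1..} - I"
  have "\<not> piecewise_syndetic (\<Union>\<gamma>\<in>J. K \<gamma>)"
    using piecewise_syndetic_UN[of J K] fin by (auto simp: J_def I_def)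
  moreover have "{1..} \<subseteq> (\<Union>\<gamma>\<in>I. K \<gamma>) \<union> (\<Union>\<gamma>\<in>J. K \<gamma>)"
    by (auto simp: J_def K_def)
  ultimately have large: "ap_large k (\<Union>\<gamma>\<in>I. K \<gamma>)" for k
    by (intro thick_imp_ap_large) (rule thick_if_not_piecewise_syndetic)
  have finI: "finite I" using fin by (simp add: I_def)
  have "\<exists>\<gamma>\<in>I. \<forall>k. ap_large k (K \<gamma>)"
  proof (rule ccontr)
    \<comment> \<open>If each class fails at its own length \<open>l \<gamma>\<close>, the sum of
      these lengths bounds all of them, and no class is large for it.\<close>
    assume "\<not> ?thesis"
    then obtain l where l: "\<And>\<gamma>. \<gamma> \<in> I \<Longrightarrow> \<not> ap_large (l \<gamma>) (K \<gamma>)" by metis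
    obtain \<gamma> where "\<gamma> \<in> I" "ap_large (\<Sum>\<gamma>\<in>I. l \<gamma>) (K \<gamma>)"
      using ap_large_UN[OF finI large] by blast
    moreover from this have "l \<gamma> \<le> (\<Sum>\<gamma>\<in>I. l \<gamma>)" using finI by (simp add: member_le_sum)
    ultimately show False using ap_large_antimono l by blast
  qed
  then show ?thesis using that unfolding I_def K_def by blast
qed

section \<open>Choosing the differences one after another\<close>

lemma multidimensional_ap_sequence:
  fixes l :: "nat \<Rightarrow> nat"
  assumes ps: "piecewise_syndetic A" and large: "\<And>k. ap_large k E"
  shows "\<exists>d. (\<forall>n. d n \<in> E) \<and>
    (\<forall>n. \<exists>a. \<forall>j. (\<forall>i<n. j i \<le> l i) \<longrightarrow> a + (\<Sum>i<n. j i * d i) \<in> A)"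
proof -
  define S where "S n B d = {x. \<forall>j\<le>l n. x + j * d \<in> B}" for n B and d :: nat
  \<comment> \<open>\<open>f n\<close> consists of starting points for the first \<open>n\<close>
    differences. Earlier differences are never changed, so one sequence serves all \<open>n\<close>;
    the clause for \<open>n = 0\<close> anchors the chain at \<open>A\<close>.\<close>
  have "\<exists>f. \<forall>n. (piecewise_syndetic (f n) \<and> (n = 0 \<longrightarrow> f n = A)) \<and>
      (\<exists>d\<in>E. f (Suc n) = S n (f n) d)"
  proof (rule dependent_nat_choice)
    show "\<exists>B. piecewise_syndetic B \<and> ((0::nat) = 0 \<longrightarrow> B = A)" using ps by blast
  next
    fix B and n :: nat
    assume "piecewise_syndetic B \<and> (n = 0 \<longrightarrow> B = A)"
    then show "\<exists>B'. (piecewise_syndetic B' \<and> (Suc n = 0 \<longrightarrow> B' = A)) \<and> (\<exists>d\<in>E. B' = S n B d)"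
      using piecewise_syndetic_ap_starts[OF _ large, of B "l n"] unfolding S_def by auto
  qed
  then obtain f d where f: "\<And>n. piecewise_syndetic (f n)" "f 0 = A"
    and d: "\<And>n. d n \<in> E" "\<And>n. f (Suc n) = S n (f n) (d n)"
    by metis
  have "x + (\<Sum>i<n. j i * d i) \<in> A" if "x \<in> f n" "\<forall>i<n. j i \<le> l i" for n x j
    using that
  proof (induction n arbitrary: x)
    case 0
    then show ?case using f(2) by simp
  next
    case (Suc n)
    then have "x + j n * d n \<in> f n" unfolding d(2) S_def by simp
    then have "x + j n * d n + (\<Sum>i<n. j i * d i) \<in> A" using Suc by simp
    then show ?case by (simp add: ac_simps)
  qed
  moreover have "\<exists>x. x \<in> f n" for n
    using f(1)[of n] not_piecewise_syndetic_empty by (metis ex_in_conv)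
  ultimately show ?thesis using d(1) by meson
qed

theorem mainTheorem1:
  fixes k :: "nat \<Rightarrow> nat" and c :: "nat \<Rightarrow> 'color"
  assumes "2 \<le> k 1"
    and "\<forall>i\<ge>1. k i \<le> k (i + 1)"
    and "finite (c ` {1..})"
  shows "\<exists>(d :: nat \<Rightarrow> nat) (\<gamma> :: 'color).
    (\<forall>i\<ge>1. d i \<ge> 1) \<and>
    (\<forall>n\<ge>1. \<exists>a\<ge>1.
      \<forall>x \<in> {a + (\<Sum>i=1..n. j i * d i) | j :: nat \<Rightarrow> nat. \<forall>i\<in>{1..n}. 0 \<le> j i \<and> j i \<le> k i - 1}.
        c x = \<gamma>) \<and>
    (\<forall>x \<in> {d i | i. i \<ge> 1}. c x = \<gamma>)"
proof -
  obtain \<gamma> where ps: "piecewise_syndetic {x. x \<ge> 1 \<and> c x = \<gamma>}"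
    and large: "\<And>k. ap_large k {x. x \<ge> 1 \<and> c x = \<gamma>}"
    using piecewise_syndetic_large_color[OF assms(3)] by blast
  let ?A = "{x. x \<ge> 1 \<and> c x = \<gamma>}"
  obtain e where e: "\<forall>n. e n \<in> ?A"
    and ap: "\<forall>n. \<exists>a. \<forall>j. (\<forall>i<n. j i \<le> k (Suc i) - 1) \<longrightarrow> a + (\<Sum>i<n. j i * e i) \<in> ?A"
    using multidimensional_ap_sequence[OF ps large, of "\<lambda>i. k (Suc i) - 1"]
    by (elim exE conjE) (rule that)
  \<comment> \<open>The chosen sequence is indexed from 0, the required one from 1.\<close>
  define d where "d i = e (i - 1)" for i
  have "\<exists>a\<ge>1. \<forall>x \<in> {a + (\<Sum>i=1..n. j i * d i) | j. \<forall>i\<in>{1..n}. 0 \<le> j i \<and> j i \<le> k i - 1}. c x = \<gamma>"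
    for n
  proof -
    obtain a where a: "\<And>j. (\<forall>i<n. j i \<le> k (Suc i) - 1) \<Longrightarrow> a + (\<Sum>i<n. j i * e i) \<in> ?A"
      using ap by blast
    \<comment> \<open>With all coefficients 0, \<open>a\<close> itself lies in the color
      class.\<close>
    have "a \<ge> 1" using a[of "\<lambda>_. 0"] by simp
    moreover have "c (a + (\<Sum>i=1..n. j i * d i)) = \<gamma>" if "\<forall>i\<in>{1..n}. j i \<le> k i - 1" for j
    proof -
      have "(\<Sum>i=1..n. j i * d i) = (\<Sum>i<n. j (Suc i) * e i)"
        by (rule sum.reindex_bij_witness[of _ Suc "\<lambda>i. i - 1"]) (auto simp: d_def)
      then show ?thesis using a[of "\<lambda>i. j (Suc i)"] that by auto
    qed
    ultimately show ?thesis by blast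
  qed
  moreover have "\<forall>i. d i \<ge> 1 \<and> c (d i) = \<gamma>" using e by (simp add: d_def)
  ultimately show ?thesis by (intro exI[of _ d] exI[of _ \<gamma>]) auto
qed

end
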